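(* For a non-nested spinal graph $G$, the set $\mathcal A^{\uparrow}_G$ of upper $G$-cyclic orders and the set $\mathcal A^{\downarrow}_G$ of lower $G$-cyclic orders are equal.
   Context: Spinal graph: a directed multigraph $G$ on vertex set $[n+1]=\{1,\dots,n+1\}$, all of whose edges $(i,i')$ go from a smaller vertex $i$ (the tail) to a larger vertex $i'$ (the head), containing at least one edge $(i,i+1)$ for each $i=1,\dots,n$. For each $i$ exactly one of the edges $(i,i+1)$ is designated the slack edge $x_i$; all other edges are non-slack. The $d$ non-slack edges are labeled $y_1,\dots,y_d$ in canonical order: increasing lexicographic order of the pairs (tail, head), with parallel edges ordered arbitrarily. $G$ is non-nested if there are no two non-slack edges $(i,j)$, $(k,l)$ with $i<k<l<j$. Total cyclic order on a finite set $X$: a ternary relation $\gamma\subseteq X^3$ such that (a) $(x,y,z)\in\gamma\Rightarrow(y,z,x)\in\gamma$; (b) $(x,y,z)\in\gamma\Rightarrow(z,y,x)\notin\gamma$; (c) $(x,y,z),(x,z,u)\in\gamma\Rightarrow(x,y,u)\in\gamma$; (d) for all distinct $x,y,z$, $(x,y,z)\in\gamma$ or $(z,y,x)\in\gamma$. Equivalently, an arrangement of $X$ on a circle up to rotation, where $(x,y,z)\in\gamma$ means that reading clockwise from $x$ one meets $y$ before $z$. "Immediately before/after" refers to adjacency in clockwise reading. For $j\in[d]$, an index $k\in[j]$ is active at $j$ if $\mathrm{head}(y_k)\le\mathrm{tail}(y_j)$ and inactive at $j$ otherwise; $\mathrm{ACT}(j)$ is the set of active indices at $j$ together with $0$, and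 $\mathrm{INACT}(j)$ the set of inactive indices at $j$. For a total cyclic order $\gamma$ on $\{0,1,\dots,d\}$ let $\mathrm{skip}(j)=|\{z\in\mathrm{ACT}(j):(j-1,z,j)\in\gamma\}|$. $\gamma$ is a $G$-cyclic order if for all $j\in[d]$, $\sum_{k\in\mathrm{INACT}(j)}\mathrm{skip}(k)<|\mathrm{ACT}(j)|$. Let $\gamma|_j$ be the restriction of $\gamma$ to $\{0,1,\dots,j\}$. A $G$-cyclic order $\gamma$ is an upper $G$-cyclic order if for every $j\in[d]$, $j$ occurs in $\gamma|_j$ immediately before an element of $\mathrm{ACT}(j)$. It is a lower $G$-cyclic order if for every $j\in[d]$, $j$ occurs in $\gamma|_j$ immediately after $j-1$ or immediately after an element of $\mathrm{ACT}(j)$. *)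

theory Defs
  imports Main "Graph_Theory.Digraph"
begin

section \<open>Spinal graphs\<close>

text \<open>
  Multigraphs are the \<^typ>\<open>('a, 'b) pre_digraph\<close> of the library: arcs are abstract, so
  parallel edges are distinct arcs with equal ends. \<^term>\<open>slack i\<close> is the edge $x_i$.
\<close>

locale spinal_graph = fin_digraph G
  for G :: "(nat, 'e) pre_digraph" +
  fixes n :: nat and slack :: "nat \<Rightarrow> 'e"
  assumes verts_eq: "verts G = {1..n + 1}"
    and tail_less_head: "e \<in> arcs G \<Longrightarrow> tail G e < head G e"
    and slack_arc: "i \<in> {1..n} \<Longrightarrow> slack i \<in> arcs G"
    and slack_tail: "i \<in> {1..n} \<Longrightarrow> tail G (slack i) = i"
    and slack_head: "i \<in> {1..n} \<Longrightarrow> head G (slack i) = i + 1"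

definition nonslack :: "(nat, 'e) pre_digraph \<Rightarrow> nat \<Rightarrow> (nat \<Rightarrow> 'e) \<Rightarrow> 'e set" where
  "nonslack G n slack = arcs G - slack ` {1..n}"

definition non_nested :: "(nat, 'e) pre_digraph \<Rightarrow> nat \<Rightarrow> (nat \<Rightarrow> 'e) \<Rightarrow> bool" where
  "non_nested G n slack \<longleftrightarrow>
     \<not> (\<exists>e \<in> nonslack G n slack. \<exists>f \<in> nonslack G n slack.
          tail G e < tail G f \<and> tail G f < head G f \<and> head G f < head G e)"

text \<open>
  The labelling $y_1, \dots, y_d$ of the non-slack edges in canonical order; any order among
  parallel edges is allowed.
\<close>

definition canonical_labelling ::
    "(nat, 'e) pre_digraph \<Rightarrow> nat \<Rightarrow> (nat \<Rightarrow> 'e) \<Rightarrow> nat \<Rightarrow> (nat \<Rightarrow> 'e) \<Rightarrow> bool" where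
  "canonical_labelling G n slack d y \<longleftrightarrow>
     bij_betw y {1..d} (nonslack G n slack) \<and>
     (\<forall>j \<in> {1..d}. \<forall>k \<in> {1..d}. j < k \<longrightarrow>
        tail G (y j) < tail G (y k) \<or>
        tail G (y j) = tail G (y k) \<and> head G (y j) \<le> head G (y k))"

section \<open>Total cyclic orders\<close>

definition total_cyclic_order :: "'a set \<Rightarrow> ('a \<times> 'a \<times> 'a) set \<Rightarrow> bool" where
  "total_cyclic_order X \<gamma> \<longleftrightarrow>
     \<gamma> \<subseteq> X \<times> X \<times> X \<and>
     (\<forall>x y z. (x, y, z) \<in> \<gamma> \<longrightarrow> (y, z, x) \<in> \<gamma>) \<and>
     (\<forall>x y z. (x, y, z) \<in> \<gamma> \<longrightarrow> (z, y, x) \<notin> \<gamma>) \<and>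
     (\<forall>x y z u. (x, y, z) \<in> \<gamma> \<longrightarrow> (x, z, u) \<in> \<gamma> \<longrightarrow> (x, y, u) \<in> \<gamma>) \<and>
     (\<forall>x \<in> X. \<forall>y \<in> X. \<forall>z \<in> X. x \<noteq> y \<longrightarrow> y \<noteq> z \<longrightarrow> x \<noteq> z \<longrightarrow>
        (x, y, z) \<in> \<gamma> \<or> (z, y, x) \<in> \<gamma>)"

text \<open>
  \<open>x\<close> occurs immediately before \<open>y\<close> (and \<open>y\<close> immediately after \<open>x\<close>) in the clockwise reading
  of \<open>\<gamma>\<close> on \<open>X\<close>. On a two-element set each element is immediately before the other.
\<close>

definition immediately_before :: "'a set \<Rightarrow> ('a \<times> 'a \<times> 'a) set \<Rightarrow> 'a \<Rightarrow> 'a \<Rightarrow> bool" where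
  "immediately_before X \<gamma> x y \<longleftrightarrow>
     x \<in> X \<and> y \<in> X \<and> x \<noteq> y \<and> \<not> (\<exists>z \<in> X. (x, z, y) \<in> \<gamma>)"

definition restrict_order ::
    "(nat \<times> nat \<times> nat) set \<Rightarrow> nat \<Rightarrow> (nat \<times> nat \<times> nat) set" where
  "restrict_order \<gamma> j = \<gamma> \<inter> {0..j} \<times> {0..j} \<times> {0..j}"

section \<open>Cyclic orders of a spinal graph\<close>

definition ACT :: "(nat, 'e) pre_digraph \<Rightarrow> (nat \<Rightarrow> 'e) \<Rightarrow> nat \<Rightarrow> nat set" where
  "ACT G y j = insert 0 {k \<in> {1..j}. head G (y k) \<le> tail G (y j)}"

definition INACT :: "(nat, 'e) pre_digraph \<Rightarrow> (nat \<Rightarrow> 'e) \<Rightarrow> nat \<Rightarrow> nat set" where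
  "INACT G y j = {k \<in> {1..j}. \<not> head G (y k) \<le> tail G (y j)}"

definition skip ::
    "(nat, 'e) pre_digraph \<Rightarrow> (nat \<Rightarrow> 'e) \<Rightarrow> (nat \<times> nat \<times> nat) set \<Rightarrow> nat \<Rightarrow> nat" where
  "skip G y \<gamma> j = card {z \<in> ACT G y j. (j - 1, z, j) \<in> \<gamma>}"

definition G_cyclic_order ::
    "(nat, 'e) pre_digraph \<Rightarrow> nat \<Rightarrow> (nat \<Rightarrow> 'e) \<Rightarrow> (nat \<times> nat \<times> nat) set \<Rightarrow> bool" where
  "G_cyclic_order G d y \<gamma> \<longleftrightarrow>
     total_cyclic_order {0..d} \<gamma> \<and>
     (\<forall>j \<in> {1..d}. (\<Sum>k \<in> INACT G y j. skip G y \<gamma> k) < card (ACT G y j))"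

definition upper_G_cyclic_orders ::
    "(nat, 'e) pre_digraph \<Rightarrow> nat \<Rightarrow> (nat \<Rightarrow> 'e) \<Rightarrow> (nat \<times> nat \<times> nat) set set" where
  "upper_G_cyclic_orders G d y =
     {\<gamma>. G_cyclic_order G d y \<gamma> \<and>
         (\<forall>j \<in> {1..d}. \<exists>a \<in> ACT G y j.
            immediately_before {0..j} (restrict_order \<gamma> j) j a)}"

definition lower_G_cyclic_orders ::
    "(nat, 'e) pre_digraph \<Rightarrow> nat \<Rightarrow> (nat \<Rightarrow> 'e) \<Rightarrow> (nat \<times> nat \<times> nat) set set" where
  "lower_G_cyclic_orders G d y =
     {\<gamma>. G_cyclic_order G d y \<gamma> \<and>
         (\<forall>j \<in> {1..d}.
            immediately_before {0..j} (restrict_order \<gamma> j) (j - 1) j \<or>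
            (\<exists>a \<in> ACT G y j. immediately_before {0..j} (restrict_order \<gamma> j) a j))}"

end

(* In a non-nested graph heads as well as tails increase along the canonical labelling, so
   ACT(j) is an initial segment {0..a} with a < j.  For an inactive index c < j, follow the walk
   c, c+1, ..., j clockwise around the circle.  If each active z were passed by some step of this
   walk, the skips of the inactive indices would add up to at least |ACT(j)|, which a G-cyclic order
   forbids.  So some active z is never passed, and cutting the circle at z puts c, c+1, ..., j in
   increasing order.  Taking for c an inactive neighbour of j in the restriction to {0..j}, one sees
   that the successor of j is always active, and so is its predecessor unless it is j-1: every
   G-cyclic order is both upper and lower. *)

theory Submission
  imports Defs
begin

section \<open>Total cyclic orders\<close>

lemma tco_rotate:
  assumes "total_cyclic_order X \<gamma>" "(x, y, z) \<in> \<gamma>"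
  shows "(y, z, x) \<in> \<gamma>"
  using assms unfolding total_cyclic_order_def by blast

lemma tco_asym:
  assumes "total_cyclic_order X \<gamma>" "(x, y, z) \<in> \<gamma>"
  shows "(z, y, x) \<notin> \<gamma>"
  using assms unfolding total_cyclic_order_def by blast

lemma tco_trans:
  assumes "total_cyclic_order X \<gamma>" "(x, y, z) \<in> \<gamma>" "(x, z, u) \<in> \<gamma>"
  shows "(x, y, u) \<in> \<gamma>"
  using assms unfolding total_cyclic_order_def by blast

lemma tco_total:
  assumes "total_cyclic_order X \<gamma>" "x \<in> X" "y \<in> X" "z \<in> X" "x \<noteq> y" "y \<noteq> z" "x \<noteq> z"
  shows "(x, y, z) \<in> \<gamma> \<or> (z, y, x) \<in> \<gamma>"
  using assms unfolding total_cyclic_order_def by blast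

lemma tco_distinct:
  assumes "total_cyclic_order X \<gamma>" "(x, y, z) \<in> \<gamma>"
  shows "x \<noteq> y" "y \<noteq> z" "x \<noteq> z"
  using tco_asym[OF assms] tco_asym[OF assms(1) tco_rotate[OF assms]]
    tco_rotate[OF assms] tco_rotate[OF assms(1) tco_rotate[OF assms]] assms(2)
  by auto

text \<open>Rotating both triples so that \<open>y\<close> comes first turns them into a chain to
  which transitivity applies. This transfers an order read from the cut \<open>z\<close> to a triple
  that no longer mentions \<open>z\<close>.\<close>

lemma tco_drop_cut:
  assumes \<gamma>: "total_cyclic_order X \<gamma>" and "(z, x, y) \<in> \<gamma>" "(z, y, u) \<in> \<gamma>"
  shows "(x, y, u) \<in> \<gamma>"
proof -
  have "(y, z, x) \<in> \<gamma>" by (rule tco_rotate[OF \<gamma> tco_rotate[OF \<gamma> assms(2)]])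
  then have "(y, u, x) \<in> \<gamma>" by (rule tco_trans[OF \<gamma> tco_rotate[OF \<gamma> assms(3)]])
  then show ?thesis by (rule tco_rotate[OF \<gamma> tco_rotate[OF \<gamma>]])
qed

lemma tco_restrict:
  assumes "total_cyclic_order X \<gamma>" "Y \<subseteq> X"
  shows "total_cyclic_order Y (\<gamma> \<inter> Y \<times> Y \<times> Y)"
  unfolding total_cyclic_order_def
proof (intro conjI ballI allI impI)
  fix x y z assume "x \<in> Y" "y \<in> Y" "z \<in> Y" "x \<noteq> y" "y \<noteq> z" "x \<noteq> z"
  then show "(x, y, z) \<in> \<gamma> \<inter> Y \<times> Y \<times> Y \<or> (z, y, x) \<in> \<gamma> \<inter> Y \<times> Y \<times> Y"
    using tco_total[OF assms(1), of x y z] assms(2) by blast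
qed (use tco_rotate[OF assms(1)] tco_asym[OF assms(1)] tco_trans[OF assms(1)] in blast)+

text \<open>Cutting the circle at \<open>x\<close> makes the remaining points a finite linear order
  \<open>?R\<close>; its minimum follows \<open>x\<close>.\<close>

lemma tco_ex_successor:
  assumes \<gamma>: "total_cyclic_order X \<gamma>" and "finite X" "x \<in> X" "X \<noteq> {x}"
  shows "\<exists>y. immediately_before X \<gamma> x y"
proof -
  let ?R = "\<lambda>u v. (x, u, v) \<in> \<gamma>"
  have asym: "asymp_on (X - {x}) ?R"
    using tco_asym[OF \<gamma>] tco_rotate[OF \<gamma>] by (intro asymp_onI) blast
  have trans: "transp_on (X - {x}) ?R"
    using tco_trans[OF \<gamma>] by (intro transp_onI) blast
  obtain y where "y \<in> X - {x}" "\<And>u. u \<in> X - {x} \<Longrightarrow> u \<noteq> y \<Longrightarrow> \<not> ?R u y"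
    using Finite_Set.bex_min_element[OF _ asym trans] assms by blast
  then show ?thesis
    using assms(3) tco_distinct[OF \<gamma>] unfolding immediately_before_def by blast
qed

lemma tco_ex_predecessor:
  assumes \<gamma>: "total_cyclic_order X \<gamma>" and "finite X" "x \<in> X" "X \<noteq> {x}"
  shows "\<exists>y. immediately_before X \<gamma> y x"
proof -
  let ?R = "\<lambda>u v. (x, u, v) \<in> \<gamma>"
  have asym: "asymp_on (X - {x}) ?R"
    using tco_asym[OF \<gamma>] tco_rotate[OF \<gamma>] by (intro asymp_onI) blast
  have trans: "transp_on (X - {x}) ?R"
    using tco_trans[OF \<gamma>] by (intro transp_onI) blast
  obtain y where "y \<in> X - {x}" "\<And>u. u \<in> X - {x} \<Longrightarrow> u \<noteq> y \<Longrightarrow> \<not> ?R y u"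
    using Finite_Set.bex_max_element[OF _ asym trans] assms by blast
  \<comment> \<open>A point between \<open>y\<close> and \<open>x\<close> would, by rotation, lie
    after \<open>y\<close> in the linear order cut at \<open>x\<close>, against maximality.\<close>
  moreover have "(x, y, u) \<in> \<gamma> \<and> u \<noteq> x \<and> u \<noteq> y" if "(y, u, x) \<in> \<gamma>" for u
    using tco_rotate[OF \<gamma> tco_rotate[OF \<gamma> that]] tco_distinct[OF \<gamma> that] by simp
  ultimately show ?thesis
    using assms(3) unfolding immediately_before_def by blast
qed

text \<open>By totality, a step that does not pass \<open>z\<close> moves forward in the linear
  order cut at \<open>z\<close>; transitivity chains the steps. As \<open>z < c\<close>, the point
  \<open>z\<close> is not on the walk, so the triples have distinct entries.\<close>

lemma tco_walk_increasing:
  fixes z c j d :: nat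
  assumes \<gamma>: "total_cyclic_order {0..d} \<gamma>" and "z < c" "c < j" "j \<le> d"
    and "\<And>m. m \<in> {c<..j} \<Longrightarrow> (m - 1, z, m) \<notin> \<gamma>"
  shows "(z, c, j) \<in> \<gamma>"
  using Suc_leI[OF \<open>c < j\<close>] assms(4,5)
proof (induction j rule: dec_induct)
  case base
  then have "(c, z, Suc c) \<notin> \<gamma>" by force
  then have "(Suc c, z, c) \<in> \<gamma>"
    using tco_total[OF \<gamma>, of c z "Suc c"] \<open>z < c\<close> base by auto
  then show ?case using tco_rotate[OF \<gamma>] by blast
next
  case (step j)
  then have "(z, c, j) \<in> \<gamma>" by simp
  moreover have "(j, z, Suc j) \<notin> \<gamma>" using step.prems(2)[of "Suc j"] step.hyps by simp
  then have "(Suc j, z, j) \<in> \<gamma>"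
    using tco_total[OF \<gamma>, of j z "Suc j"] \<open>z < c\<close> step by auto
  then have "(z, j, Suc j) \<in> \<gamma>" using tco_rotate[OF \<gamma>] by blast
  ultimately show ?case using tco_trans[OF \<gamma>] by blast
qed

section \<open>Active indices\<close>

lemma heads_mono:
  assumes "spinal_graph G n slack" "canonical_labelling G n slack d y" "non_nested G n slack"
    and "1 \<le> i" "i \<le> k" "k \<le> d"
  shows "head G (y i) \<le> head G (y k)"
proof (cases "i = k")
  case False
  have y: "y i \<in> nonslack G n slack" "y k \<in> nonslack G n slack"
    using assms unfolding canonical_labelling_def bij_betw_def by auto
  then have "tail G (y k) < head G (y k)"
    using spinal_graph.tail_less_head[OF assms(1)] unfolding nonslack_def by auto
  moreover have "tail G (y i) < tail G (y k) \<or>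
      tail G (y i) = tail G (y k) \<and> head G (y i) \<le> head G (y k)"
    using assms False unfolding canonical_labelling_def by auto
  \<comment> \<open>If the tail strictly increased while the head decreased, \<open>y k\<close>
    would be nested in \<open>y i\<close>.\<close>
  ultimately show ?thesis
    using assms(3) y unfolding non_nested_def by (meson not_le)
qed simp

text \<open>Heads increase with the label, so a smaller label meets the same bound
  \<open>tail G (y j)\<close>. Non-nestedness enters the later arguments in this form.\<close>

lemma ACT_downward_closed:
  assumes "spinal_graph G n slack" "canonical_labelling G n slack d y" "non_nested G n slack"
    and "j \<le> d" "k \<in> ACT G y j" "i \<le> k"
  shows "i \<in> ACT G y j"
proof (cases "i = 0")
  case False
  with assms have "head G (y i) \<le> head G (y k)"
    by (intro heads_mono[OF assms(1-3)]) (auto simp: ACT_def)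
  with False assms show ?thesis by (auto simp: ACT_def)
qed (simp add: ACT_def)

lemma ACT_less:
  assumes "spinal_graph G n slack" "canonical_labelling G n slack d y"
    and "j \<in> {1..d}" "k \<in> ACT G y j"
  shows "k < j"
proof -
  have "y j \<in> arcs G"
    using assms(2,3) bij_betwE[of y "{1..d}"] unfolding canonical_labelling_def nonslack_def by blast
  then have "tail G (y j) < head G (y j)"
    by (rule spinal_graph.tail_less_head[OF assms(1)])
  then show ?thesis using assms(3,4) by (cases "k = j") (auto simp: ACT_def)
qed

lemma finite_ACT: "finite (ACT G y j)"
  unfolding ACT_def by simp

text \<open>Union bound: otherwise the sets counted by the skips of the inactive indices would cover
  \<open>ACT G y j\<close>. The proviso \<open>z \<in> ACT G y m\<close> is there because
  \<open>skip\<close> counts only such elements.\<close>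

lemma not_all_ACT_skipped:
  assumes "G_cyclic_order G d y \<gamma>" "j \<in> {1..d}" "M \<subseteq> INACT G y j"
  shows "\<exists>z \<in> ACT G y j. \<forall>m \<in> M. z \<in> ACT G y m \<longrightarrow> (m - 1, z, m) \<notin> \<gamma>"
proof (rule ccontr)
  assume "\<not> ?thesis"
  then have sub: "ACT G y j \<subseteq> (\<Union>m\<in>INACT G y j. {z \<in> ACT G y m. (m - 1, z, m) \<in> \<gamma>})"
    using assms(3) by blast
  have "finite (INACT G y j)" unfolding INACT_def by simp
  have "card (ACT G y j) \<le> card (\<Union>m\<in>INACT G y j. {z \<in> ACT G y m. (m - 1, z, m) \<in> \<gamma>})"
    by (rule card_mono[OF _ sub]) (simp add: \<open>finite (INACT G y j)\<close> finite_ACT)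
  also have "\<dots> \<le> (\<Sum>m\<in>INACT G y j. skip G y \<gamma> m)"
    unfolding skip_def by (rule card_UN_le) fact
  finally show False
    using assms(1,2) unfolding G_cyclic_order_def by (meson not_le)
qed

section \<open>Walks through consecutive indices in a G-cyclic order\<close>

context
  fixes G :: "(nat, 'e) pre_digraph" and n d :: nat and slack y :: "nat \<Rightarrow> 'e"
    and \<gamma> :: "(nat \<times> nat \<times> nat) set"
  assumes G: "spinal_graph G n slack" "canonical_labelling G n slack d y" "non_nested G n slack"
    and \<gamma>: "G_cyclic_order G d y \<gamma>"
begin

lemma tco: "total_cyclic_order {0..d} \<gamma>"
  using \<gamma> unfolding G_cyclic_order_def by blast

lemma walk_subset_INACT:
  assumes "j \<in> {1..d}" "c < j" "c \<notin> ACT G y j"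
  shows "{c<..j} \<subseteq> INACT G y j"
proof
  fix m assume "m \<in> {c<..j}"
  then have "m \<notin> ACT G y j"
    using ACT_downward_closed[OF G, of j m c] assms by auto
  with \<open>m \<in> {c<..j}\<close> show "m \<in> INACT G y j" by (auto simp: ACT_def INACT_def)
qed

lemma ACT_less_inactive:
  assumes "j \<in> {1..d}" "c \<notin> ACT G y j" "z \<in> ACT G y j"
  shows "z < c"
  using ACT_downward_closed[OF G, of j z c] assms by (meson atLeastAtMost_iff not_le)

(* A step j-1 -> j counts in skip(j) only the elements of ACT(j) that it passes; hence it passes no
   other element below j, and passing z at any step of a walk does contribute to the sum of skips. *)
lemma passed_imp_ACT:
  assumes "j \<in> {1..d}" "c < j" "(j - 1, c, j) \<in> \<gamma>"
  shows "c \<in> ACT G y j"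
  using assms
proof (induction j arbitrary: c rule: less_induct)
  case (less j)
  show ?case
  proof (rule ccontr)
    assume c: "c \<notin> ACT G y j"
    obtain z where z: "z \<in> ACT G y j"
      and not_skipped: "\<And>m. m \<in> {c<..j} \<Longrightarrow> z \<in> ACT G y m \<Longrightarrow> (m - 1, z, m) \<notin> \<gamma>"
      using not_all_ACT_skipped[OF \<gamma> less.prems(1) walk_subset_INACT[OF less.prems(1,2) c]] by blast
    have "z < c" using ACT_less_inactive[OF less.prems(1) c z] .
    \<comment> \<open>For \<open>m < j\<close> the induction hypothesis makes a passed
      \<open>z\<close> active at \<open>m\<close>, hence skipped there; at \<open>m = j\<close> the
      point \<open>z\<close> is active by choice.\<close>
    have not_passed: "(m - 1, z, m) \<notin> \<gamma>" if "m \<in> {c<..j}" for m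
    proof (cases "m = j")
      case False
      then show ?thesis
        using less.IH[of m z] not_skipped[of m] that \<open>z < c\<close> less.prems(1) by auto
    qed (use not_skipped z that in blast)
    have "c \<noteq> j - 1" using tco_distinct[OF tco less.prems(3)] by simp
    then have "c < j - 1" using less.prems(2) by simp
    \<comment> \<open>Read from the cut \<open>z\<close>, the order is \<open>c\<close>,
      \<open>j - 1\<close>, \<open>j\<close>: the opposite orientation to the assumed
      \<open>(j - 1, c, j)\<close>.\<close>
    have "(z, c, j - 1) \<in> \<gamma>"
      using tco_walk_increasing[OF tco \<open>z < c\<close> \<open>c < j - 1\<close>] not_passed less.prems(1)
      by (meson atLeastAtMost_iff diff_le_self greaterThanAtMost_iff le_trans)
    moreover have "(z, j - 1, j) \<in> \<gamma>"
      using tco_walk_increasing[OF tco, of z "j - 1" j] not_passed less.prems(1) \<open>z < c\<close> \<open>c < j - 1\<close>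
      by auto
    ultimately have "(c, j - 1, j) \<in> \<gamma>" by (rule tco_drop_cut[OF tco])
    then show False
      using tco_asym[OF tco tco_rotate[OF tco less.prems(3)]] tco_rotate[OF tco] by blast
  qed
qed

text \<open>The counting argument yields a \<open>z\<close> that is not skipped on the walk from
  \<open>c\<close> to \<open>j\<close>. By \<open>passed_imp_ACT\<close> it is not passed at all, so
  every subwalk is increasing from the cut \<open>z\<close>.\<close>

lemma ex_cut_walk_increasing:
  assumes j: "j \<in> {1..d}" and c: "c < j" "c \<notin> ACT G y j"
  shows "\<exists>z \<in> ACT G y j. \<forall>k l. c \<le> k \<longrightarrow> k < l \<longrightarrow> l \<le> j \<longrightarrow> (z, k, l) \<in> \<gamma>"
proof -
  obtain z where z: "z \<in> ACT G y j"
    and not_skipped: "\<And>m. m \<in> {c<..j} \<Longrightarrow> z \<in> ACT G y m \<Longrightarrow> (m - 1, z, m) \<notin> \<gamma>"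
    using not_all_ACT_skipped[OF \<gamma> j walk_subset_INACT[OF j c]] by blast
  have "z < c" using ACT_less_inactive[OF j c(2) z] .
  then have "(m - 1, z, m) \<notin> \<gamma>" if "m \<in> {c<..j}" for m
    using passed_imp_ACT[of m z] not_skipped[of m] that j by auto
  then have "(z, k, l) \<in> \<gamma>" if "c \<le> k" "k < l" "l \<le> j" for k l
    using tco_walk_increasing[OF tco, of z k l] that \<open>z < c\<close> j by auto
  with z show ?thesis by blast
qed

lemma tco_restrict_order:
  assumes "j \<in> {1..d}"
  shows "total_cyclic_order {0..j} (restrict_order \<gamma> j)"
  unfolding restrict_order_def using assms by (intro tco_restrict[OF tco]) auto

lemma successor_ACT:
  assumes j: "j \<in> {1..d}"
  shows "\<exists>a \<in> ACT G y j. immediately_before {0..j} (restrict_order \<gamma> j) j a"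
proof -
  obtain s where s: "immediately_before {0..j} (restrict_order \<gamma> j) j s"
    using tco_ex_successor[OF tco_restrict_order[OF j], of j] j by fastforce
  then have "s < j" by (auto simp: immediately_before_def)
  have "s \<in> ACT G y j"
  proof (rule ccontr)
    assume "s \<notin> ACT G y j"
    then obtain z where z: "z \<in> ACT G y j" "(z, s, j) \<in> \<gamma>"
      using ex_cut_walk_increasing[OF j \<open>s < j\<close>] \<open>s < j\<close> by blast
    \<comment> \<open>The cut point itself separates \<open>j\<close> from the supposed successor
      \<open>s\<close>; it survives the restriction since active indices are below
      \<open>j\<close>.\<close>
    then have "(j, z, s) \<in> restrict_order \<gamma> j"
      using tco_rotate[OF tco] ACT_less[OF G(1,2) j] \<open>s < j\<close> unfolding restrict_order_def
      by fastforce
    with s ACT_less[OF G(1,2) j z(1)] show False unfolding immediately_before_def by auto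
  qed
  with s show ?thesis by blast
qed

lemma predecessor_ACT:
  assumes j: "j \<in> {1..d}"
  shows "immediately_before {0..j} (restrict_order \<gamma> j) (j - 1) j \<or>
    (\<exists>a \<in> ACT G y j. immediately_before {0..j} (restrict_order \<gamma> j) a j)"
proof -
  obtain p where p: "immediately_before {0..j} (restrict_order \<gamma> j) p j"
    using tco_ex_predecessor[OF tco_restrict_order[OF j], of j] j by fastforce
  then have "p < j" by (auto simp: immediately_before_def)
  have "p = j - 1 \<or> p \<in> ACT G y j"
  proof (rule ccontr)
    assume *: "\<not> ?thesis"
    with \<open>p < j\<close> have "p < j - 1" "j - 1 < j" by linarith+
    \<comment> \<open>Here the separating point is \<open>j - 1\<close>, which the increasing walk
      places between \<open>p\<close> and \<open>j\<close>.\<close>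
    then obtain z where "(z, p, j - 1) \<in> \<gamma>" "(z, j - 1, j) \<in> \<gamma>"
      using ex_cut_walk_increasing[OF j \<open>p < j\<close>] *
      by (meson diff_le_self less_imp_le order_refl)
    then have "(p, j - 1, j) \<in> \<gamma>" by (rule tco_drop_cut[OF tco])
    then have "(p, j - 1, j) \<in> restrict_order \<gamma> j"
      using \<open>p < j\<close> unfolding restrict_order_def by simp
    with p show False unfolding immediately_before_def by auto
  qed
  with p show ?thesis by blast
qed

end

theorem proposition5p7:
  fixes G :: "(nat, 'e) pre_digraph"
    and n d :: nat
    and slack y :: "nat \<Rightarrow> 'e"
  assumes "spinal_graph G n slack"
    and "canonical_labelling G n slack d y"
    and "non_nested G n slack"
  shows "upper_G_cyclic_orders G d y = lower_G_cyclic_orders G d y"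
  unfolding upper_G_cyclic_orders_def lower_G_cyclic_orders_def
  using successor_ACT[OF assms] predecessor_ACT[OF assms] by blast

end
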